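(* Every cubic surface in $\mathbb{C}[x,y,z,t]$ is Pfaffian. That is, for every homogeneous polynomial $f(x,y,z,t)\in\mathbb{C}[x,y,z,t]$ of degree three, there exist $6\times 6$ skew-symmetric matrices $A_0,A_1,A_2,A_3$ with entries in $\mathbb{C}$ such that the matrix $M=xA_0+yA_1+zA_2+tA_3$ satisfies $$\det M=f(x,y,z,t)^2$$ as an identity in $\mathbb{C}[x,y,z,t]$.
   Context: A cubic surface in $\mathbb{C}[x,y,z,t]$ means a homogeneous polynomial $f(x,y,z,t)$ of degree three with coefficients in $\mathbb{C}$ (an arbitrary linear combination of the 20 monomials of degree three in $x,y,z,t$; no smoothness or irreducibility is assumed). Such an $f$ is called Pfaffian if there exists a matrix $M=xA_0+yA_1+zA_2+tA_3$, where $A_0,A_1,A_2,A_3$ are $6\times 6$ skew-symmetric matrices with entries in $\mathbb{C}$, such that $\det M=f(x,y,z,t)^2$. *)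

theory Defs
  imports "HOL-Analysis.Determinants" "HOL-Library.Poly_Mapping"
begin

(* The polynomial ring in four variables over the complex numbers: finitely supported
   functions from exponent vectors to coefficients, with the convolution product of
   Poly_Mapping. The variables x, y, z, t are indexed by 0, 1, 2, 3 in the type 4. *)
type_synonym poly4 = "(4 \<Rightarrow>\<^sub>0 nat) \<Rightarrow>\<^sub>0 complex"

definition Const :: "complex \<Rightarrow> poly4" where
  "Const c = Poly_Mapping.single 0 c"

definition Var :: "4 \<Rightarrow> poly4" where
  "Var i = Poly_Mapping.single (Poly_Mapping.single i 1) 1"

definition total_deg :: "(4 \<Rightarrow>\<^sub>0 nat) \<Rightarrow> nat" where
  "total_deg m = (\<Sum>i\<in>UNIV. Poly_Mapping.lookup m i)"

(* The zero polynomial is homogeneous of every degree, so it counts as a cubic surface. *)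
definition homogeneous :: "nat \<Rightarrow> poly4 \<Rightarrow> bool" where
  "homogeneous d f \<longleftrightarrow> (\<forall>m \<in> Poly_Mapping.keys f. total_deg m = d)"

definition cubic_surface :: "poly4 \<Rightarrow> bool" where
  "cubic_surface f \<longleftrightarrow> homogeneous 3 f"

definition skew_symmetric :: "complex^'n^'n \<Rightarrow> bool" where
  "skew_symmetric A \<longleftrightarrow> transpose A = - A"

definition linear_matrix ::
  "complex^6^6 \<Rightarrow> complex^6^6 \<Rightarrow> complex^6^6 \<Rightarrow> complex^6^6 \<Rightarrow> poly4^6^6" where
  "linear_matrix A0 A1 A2 A3 =
     (\<chi> i j. Var 0 * Const (A0 $ i $ j) + Var 1 * Const (A1 $ i $ j)
           + Var 2 * Const (A2 $ i $ j) + Var 3 * Const (A3 $ i $ j))"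

definition Pfaffian :: "poly4 \<Rightarrow> bool" where
  "Pfaffian f \<longleftrightarrow>
     (\<exists>A0 A1 A2 A3 :: complex^6^6.
        skew_symmetric A0 \<and> skew_symmetric A1 \<and> skew_symmetric A2 \<and> skew_symmetric A3 \<and>
        det (linear_matrix A0 A1 A2 A3) = f\<^sup>2)"

end

theory Submission
  imports Defs "HOL-Computational_Algebra.Fundamental_Theorem_Algebra"
begin

text \<open>The matrix of linear forms
\<open>M = [[A, B], [- B\<^sup>T, C]]\<close>, where \<open>A\<close> and \<open>C\<close> are the skew 3 by 3 matrices of
vectors \<open>a\<close> and \<open>c\<close>, has Pfaffian \<open>det B + a\<^sup>T B c\<close> up to signs of the terms. A sparse
choice of \<open>B\<close>, \<open>a\<close>, \<open>c\<close> turns this into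
  \<open>b1 (l1 t + y z) + b2 (l2 t + x z) + b3 (l3 t + x y)\<close>,
with ten freely chosen linear forms (\<open>det_skew_eq_square\<close>, \<open>Pfaffian_of_linear_forms\<close>).
It remains to bring every cubic into this shape.

Suppose that the cubic has four linearly independent zeros. In the coordinates
\<open>x, y, z, t\<close> dual to them it contains no cube of a coordinate. The part without \<open>t\<close> is then
\<open>b1 y z + b2 x z + b3 x y\<close> for linear forms \<open>b1, b2, b3\<close> in \<open>x, y, z\<close>, and the rest is
\<open>t Q\<close> with \<open>Q\<close> in the ideal \<open>(x, y, z)\<close>. The monomial \<open>x y z\<close> may be split
among the three products in any proportion, and this freedom always suffices to make
\<open>b1, b2, b3\<close> linearly independent. They then generate \<open>(x, y, z)\<close>, so
\<open>Q = b1 l1 + b2 l2 + b3 l3\<close>, which is the required shape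
(\<open>cubic_without_cubes_normal_form\<close>).

If there are no four independent zeros, all zeros lie in a plane \<open>\<lambda> = 0\<close>. A line parallel
to that plane and outside it contains no zero, so the cubic is constant on it by the fundamental
theorem of algebra; hence the cubic is a multiple of \<open>\<lambda>\<^sup>3\<close>
(\<open>tensor_concentrated_of_zeros_in_hyperplane\<close>), and this is again of the required shape.\<close>

section \<open>The determinant of a sparse skew matrix\<close>

text \<open>The determinant with its columns relabelled by \<open>h\<close> and restricted to the index set \<open>S\<close>.
The relabelling makes deletion of a row and a column expressible without changing the index
type: moving column \<open>b\<close> into place \<open>a\<close> is composition with a transposition.\<close>

definition signed_sum :: "'n set \<Rightarrow> ('n \<Rightarrow> 'n) \<Rightarrow> ('n \<Rightarrow> 'n \<Rightarrow> 'a::comm_ring_1) \<Rightarrow> 'a" where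
  "signed_sum S h A = (\<Sum>p | p permutes S. of_int (sign p) * (\<Prod>i\<in>S. A i (h (p i))))"

lemma signed_sum_empty [simp]: "signed_sum {} h A = 1"
  by (simp add: signed_sum_def sign_id)

lemma signed_sum_insert:
  fixes A :: "'n \<Rightarrow> 'n \<Rightarrow> 'a::comm_ring_1"
  assumes "finite S" "a \<notin> S"
  shows "signed_sum (insert a S) h A =
    (\<Sum>b\<in>insert a S. (if a = b then 1 else - 1) * A a (h b) * signed_sum S (h \<circ> Transposition.transpose a b) A)"
proof -
  have "of_int (sign (Transposition.transpose a b \<circ> q)) * (\<Prod>i\<in>insert a S. A i (h ((Transposition.transpose a b \<circ> q) i)))
     = (if a = b then 1 else - 1) * A a (h b) *
       (of_int (sign q) * (\<Prod>i\<in>S. A i ((h \<circ> Transposition.transpose a b) (q i))))"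
    if q: "q permutes S" for q b
  proof -
    have "q a = a" using q assms(2) by (simp add: permutes_not_in)
    moreover have "permutation q" using q assms(1) by (auto simp: permutation_permutes)
    then have "sign (Transposition.transpose a b \<circ> q) = (if a = b then 1 else - 1) * sign q"
      by (simp only: sign_compose permutation_swap_id sign_swap_id)
    ultimately show ?thesis using assms by (simp add: algebra_simps)
  qed
  then show ?thesis
    unfolding signed_sum_def sum_over_permutations_insert[OF assms]
    by (simp add: sum_distrib_left)
qed

lemma det_eq_signed_sum: "det A = signed_sum UNIV id (\<lambda>i j. A $ i $ j)"
  by (simp add: det_def signed_sum_def)

text \<open>The same recursion on explicit lists of row and column indices, where it can be evaluated by
rewriting. A column is brought to the front by exchanging it with the first one, so every
term but the first has sign \<open>-1\<close>.\<close>

fun swap_det :: "('n \<Rightarrow> 'n \<Rightarrow> 'a::comm_ring_1) \<Rightarrow> 'n list \<Rightarrow> 'n list \<Rightarrow> 'a" where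
  "swap_det A (r # rs) (c # cs) =
     A r c * swap_det A rs cs - (\<Sum>i<length cs. A r (cs ! i) * swap_det A rs (cs[i := c]))"
| "swap_det A _ _ = 1"

declare swap_det.simps [simp del]

lemma signed_sum_eq_swap_det:
  "distinct rs \<Longrightarrow> signed_sum (set rs) h A = swap_det A rs (map h rs)"
proof (induction rs arbitrary: h)
  case Nil
  show ?case by (simp add: swap_det.simps)
next
  case (Cons r rs)
  have column: "map (h \<circ> Transposition.transpose r (rs ! i)) rs = (map h rs)[i := h r]"
    if "i < length rs" for i
    using that Cons.prems
    by (intro nth_equalityI) (auto simp: nth_list_update nth_eq_iff_index_eq Transposition.transpose_def)
  have "(\<Sum>b\<in>set rs. g b) = (\<Sum>i<length rs. g (rs ! i))" for g :: "'a \<Rightarrow> 'b"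
    using Cons.prems by (intro sum.reindex_bij_betw[symmetric] bij_betw_nth) auto
  moreover have "(\<Sum>i<length rs. (if r = rs ! i then 1 else - 1) * A r (h (rs ! i)) *
        signed_sum (set rs) (h \<circ> Transposition.transpose r (rs ! i)) A)
     = (\<Sum>i<length rs. - (A r (map h rs ! i) * swap_det A rs ((map h rs)[i := h r])))"
    using Cons by (intro sum.cong refl) (auto simp: column)
  ultimately show ?case
    using Cons by (simp add: signed_sum_insert swap_det.simps sum_negf o_def)
qed

lemma det_eq_swap_det:
  assumes "distinct rs" "set rs = UNIV"
  shows "det A = swap_det (\<lambda>i j. A $ i $ j) rs rs"
  using signed_sum_eq_swap_det[OF assms(1), of id "\<lambda>i j. A $ i $ j"]
  by (simp add: det_eq_signed_sum assms(2))

lemma UNIV_6: "(UNIV :: 6 set) = {0, 1, 2, 3, 4, 5}"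
proof (rule sym, rule card_seteq)
  show "card (UNIV :: 6 set) \<le> card {0, 1, 2, 3, 4, 5 :: 6}" by simp
qed auto

text \<open>With \<open>B\<close> the matrix with rows \<open>(b1, 0, 0)\<close>, \<open>(l2, z, 0)\<close>, \<open>(l3, y, y)\<close>,
and \<open>- A\<close>, \<open>C\<close> the skew matrices of the cross products with \<open>a = (l1, b2, b3)\<close> and
\<open>c = (t, x, 0)\<close>, the matrix below minus its transpose is the skew block matrix with
diagonal blocks \<open>A\<close>, \<open>C\<close> and upper right block \<open>B\<close>. Its Pfaffian is, up to an
overall sign, \<open>det B + a\<^sup>T B c\<close>. Each nonzero entry is stored once, at that one of its two
places where its sign is positive.\<close>

definition pfaffian_half :: "'a::zero \<Rightarrow> 'a \<Rightarrow> 'a \<Rightarrow> 'a \<Rightarrow> 'a \<Rightarrow> 'a \<Rightarrow> 'a \<Rightarrow> 'a \<Rightarrow> 'a \<Rightarrow> 'a \<Rightarrow> 6 \<Rightarrow> 6 \<Rightarrow> 'a" where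
 "pfaffian_half x y z t b1 b2 b3 l1 l2 l3 i j =
    (if i = 0 then if j = 1 then b3 else if j = 3 then b1 else 0
     else if i = 1 then if j = 2 then l1 else if j = 3 then l2 else if j = 4 then z else 0
     else if i = 2 then if j = 0 then b2 else if j = 3 then l3 else if j = 4 \<or> j = 5 then y else 0
     else if i = 3 then if j = 5 then x else 0
     else if i = 5 then if j = 4 then t else 0
     else 0)"

text \<open>This is the identity det = Pf\<open>\<^sup>2\<close> for the one matrix that is needed, valid in every
commutative ring.\<close>

lemma det_skew_eq_square:
  fixes x y z t b1 b2 b3 l1 l2 l3 :: "'a::comm_ring_1"
  defines "u \<equiv> pfaffian_half x y z t b1 b2 b3 l1 l2 l3"
  shows "det (\<chi> i j. u i j - u j i) = (b1 * (l1 * t + y * z) + b2 * (l2 * t + x * z) + b3 * (l3 * t + x * y))\<^sup>2"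
proof -
  define M where "M i j = u i j - u j i" for i j
  \<comment> \<open>The rows with the fewest nonzero entries come first.\<close>
  have rows: "set [0, 4, 5, 3, 1, 2] = (UNIV :: 6 set)" unfolding UNIV_6 by auto
  have M:
    "M 0 0 = 0" "M 0 1 = b3" "M 0 2 = - b2" "M 0 3 = b1" "M 0 4 = 0" "M 0 5 = 0"
    "M 1 0 = - b3" "M 1 1 = 0" "M 1 2 = l1" "M 1 3 = l2" "M 1 4 = z" "M 1 5 = 0"
    "M 2 0 = b2" "M 2 1 = - l1" "M 2 2 = 0" "M 2 3 = l3" "M 2 4 = y" "M 2 5 = y"
    "M 3 0 = - b1" "M 3 1 = - l2" "M 3 2 = - l3" "M 3 3 = 0" "M 3 4 = 0" "M 3 5 = x"
    "M 4 0 = 0" "M 4 1 = - z" "M 4 2 = - y" "M 4 3 = 0" "M 4 4 = 0" "M 4 5 = - t"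
    "M 5 0 = 0" "M 5 1 = 0" "M 5 2 = - y" "M 5 3 = - x" "M 5 4 = t" "M 5 5 = 0"
    by (simp_all add: M_def u_def pfaffian_half_def)
  have "det (\<chi> i j. u i j - u j i) = swap_det M [0, 4, 5, 3, 1, 2] [0, 4, 5, 3, 1, 2]"
  proof -
    have "(\<lambda>i j. (\<chi> i j. u i j - u j i) $ i $ j) = M" by (simp add: fun_eq_iff M_def)
    then show ?thesis using det_eq_swap_det[OF _ rows, of "\<chi> i j. u i j - u j i"] by simp
  qed
  also have "\<dots> = (b1 * (l1 * t + y * z) + b2 * (l2 * t + x * z) + b3 * (l3 * t + x * y))\<^sup>2"
    \<comment> \<open>Unfolding one row at a time lets the zero entries remove their minors
      before those minors are expanded; unrestricted unfolding would visit all 720 terms.\<close>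
    by (simp add: swap_det.simps(1)[of M 0 "[4, 5, 3, 1, 2]"] M lessThan_Suc,
        simp add: swap_det.simps(1)[of M 4 "[5, 3, 1, 2]"] M lessThan_Suc,
        simp add: swap_det.simps(1)[of M 5 "[3, 1, 2]"] M lessThan_Suc,
        simp add: swap_det.simps(1)[of M 3 "[1, 2]"] M lessThan_Suc,
        simp add: swap_det.simps(1)[of M 1 "[2]"] M lessThan_Suc,
        simp add: swap_det.simps M,
        simp add: algebra_simps power2_eq_square)
  finally show ?thesis .
qed

section \<open>Cubic forms as symmetric tensors\<close>

lemma Const_simps:
  "Const 0 = 0" "Const 1 = 1" "Const (numeral n) = numeral n"
  "Const (c + d) = Const c + Const d" "Const (c * d) = Const c * Const d"
  "Const (c - d) = Const c - Const d"
  by (simp_all add: Const_def single_add mult_single single_diff)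

lemma Const_sum: "Const (sum g S) = (\<Sum>s\<in>S. Const (g s))"
  by (induction S rule: infinite_finite_induct) (simp_all add: Const_simps)

lemma monomial_eq_single:
  "Const c * Var i * Var j * Var k =
     Poly_Mapping.single (Poly_Mapping.single i 1 + Poly_Mapping.single j 1 + Poly_Mapping.single k 1) c"
  by (simp add: Const_def Var_def mult_single)

lemma total_deg_SucE:
  assumes "total_deg m = Suc n"
  obtains i m' where "m = Poly_Mapping.single i 1 + m'" "total_deg m' = n"
proof -
  obtain i where i: "Poly_Mapping.lookup m i > 0"
    using assms unfolding total_deg_def by (metis gr0I nat.distinct(1) sum.neutral)
  let ?m' = "m - Poly_Mapping.single i 1"
  have m: "m = Poly_Mapping.single i 1 + ?m'"
    using i by (intro poly_mapping_eqI) (auto simp: lookup_add lookup_minus lookup_single when_def)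
  have "total_deg m = 1 + total_deg ?m'"
    by (subst m) (simp add: total_deg_def lookup_add sum.distrib lookup_single when_def)
  then have "total_deg ?m' = n" using assms by simp
  with m show thesis by (rule that)
qed

lemma total_deg_3E:
  assumes "total_deg m = 3"
  obtains i j k where
    "m = Poly_Mapping.single i 1 + Poly_Mapping.single j 1 + Poly_Mapping.single k 1"
proof -
  have "total_deg m = Suc (Suc (Suc 0))" using assms by simp
  then obtain i m1 where 1: "m = Poly_Mapping.single i 1 + m1" "total_deg m1 = Suc (Suc 0)"
    by (rule total_deg_SucE)
  from 1(2) obtain j m2 where 2: "m1 = Poly_Mapping.single j 1 + m2" "total_deg m2 = Suc 0"
    by (rule total_deg_SucE)
  from 2(2) obtain k m3 where 3: "m2 = Poly_Mapping.single k 1 + m3" "total_deg m3 = 0"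
    by (rule total_deg_SucE)
  have "m3 = 0" using 3(2) by (intro poly_mapping_eqI) (simp add: total_deg_def)
  with 1 2 3 show thesis by (intro that[of i j k]) (simp add: add.assoc)
qed

lemma sum_triples:
  "(\<Sum>i\<in>UNIV. \<Sum>j\<in>UNIV. \<Sum>k\<in>UNIV. g i j k) = (\<Sum>(i, j, k)\<in>UNIV. g i j k)"
  by (simp add: sum.cartesian_product flip: UNIV_Times_UNIV)

lemma product_of_three_sums:
  fixes c :: "'a::comm_ring_1" and x y z :: "'n::finite \<Rightarrow> 'a"
  shows "c * (\<Sum>i\<in>UNIV. x i) * (\<Sum>j\<in>UNIV. y j) * (\<Sum>k\<in>UNIV. z k)
    = (\<Sum>(i, j, k)\<in>UNIV. c * x i * y j * z k)"
  by (simp only: sum_triples[symmetric] sum_distrib_left[symmetric] sum_distrib_right[symmetric])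

text \<open>Each coefficient is shared equally among the ordered triples of variables whose product is its
monomial; the number of these triples is a multinomial coefficient. Symmetry is what allows the
tensor to be recovered later from the values of the cubic by polarization.\<close>

lemma cubic_eq_symmetric_form:
  assumes "cubic_surface f"
  shows "\<exists>a :: 4 \<Rightarrow> 4 \<Rightarrow> 4 \<Rightarrow> complex.
    (\<forall>i j k. a i j k = a j i k) \<and> (\<forall>i j k. a i j k = a i k j) \<and>
    f = (\<Sum>i\<in>UNIV. \<Sum>j\<in>UNIV. \<Sum>k\<in>UNIV. Const (a i j k) * Var i * Var j * Var k)"
proof -
  define e :: "4 \<Rightarrow> 4 \<Rightarrow>\<^sub>0 nat" where "e i = Poly_Mapping.single i 1" for i
  define mon where "mon = (\<lambda>(i, j, k). e i + e j + e k)"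
  \<comment> \<open>The number of orderings of a monomial: 1, 3 or 6.\<close>
  define orderings where "orderings m = card {s. mon s = m}" for m
  define a where "a i j k = Poly_Mapping.lookup f (mon (i, j, k)) / orderings (mon (i, j, k))" for i j k
  have "f = (\<Sum>s\<in>UNIV. Poly_Mapping.single (mon s) (Poly_Mapping.lookup f (mon s) / orderings (mon s)))"
  proof (rule poly_mapping_eqI)
    fix m
    have "(\<Sum>s\<in>UNIV. Poly_Mapping.lookup f (mon s) / orderings (mon s) when mon s = m)
        = (\<Sum>s\<in>{s. mon s = m}. Poly_Mapping.lookup f m / orderings m)"
      by (rule sum.mono_neutral_cong_right) (auto simp: when_def)
    also have "\<dots> = Poly_Mapping.lookup f m"
    proof (cases "Poly_Mapping.lookup f m = 0")
      case False
      then have "m \<in> Poly_Mapping.keys f" by (simp add: in_keys_iff)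
      then have "total_deg m = 3"
        using assms by (simp add: cubic_surface_def homogeneous_def)
      then obtain i j k where "m = e i + e j + e k"
        unfolding e_def by (rule total_deg_3E)
      then have "(i, j, k) \<in> {s. mon s = m}" by (simp add: mon_def)
      then have "orderings m \<noteq> 0" unfolding orderings_def by (metis card_eq_0_iff empty_iff finite)
      then show ?thesis by (simp add: orderings_def)
    qed simp
    finally show "Poly_Mapping.lookup f m = Poly_Mapping.lookup (\<Sum>s\<in>UNIV. Poly_Mapping.single (mon s) (Poly_Mapping.lookup f (mon s) / orderings (mon s))) m"
      by (simp add: lookup_sum lookup_single)
  qed
  also have "\<dots> = (\<Sum>(i, j, k)\<in>UNIV. Const (a i j k) * Var i * Var j * Var k)"
    by (rule sum.cong) (auto simp: a_def monomial_eq_single mon_def e_def)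
  finally have f: "f = (\<Sum>i\<in>UNIV. \<Sum>j\<in>UNIV. \<Sum>k\<in>UNIV. Const (a i j k) * Var i * Var j * Var k)"
    by (simp only: sum_triples)
  have "a i j k = a j i k" "a i j k = a i k j" for i j k
    by (simp_all add: a_def mon_def add.commute add.left_commute)
  with f show ?thesis by blast
qed

definition trilinear ::
  "('n::finite \<Rightarrow> 'n \<Rightarrow> 'n \<Rightarrow> 'a::comm_ring_1) \<Rightarrow> 'a^'n \<Rightarrow> 'a^'n \<Rightarrow> 'a^'n \<Rightarrow> 'a" where
  "trilinear a p q r = (\<Sum>i\<in>UNIV. \<Sum>j\<in>UNIV. \<Sum>k\<in>UNIV. a i j k * p $ i * q $ j * r $ k)"

lemma trilinear_add_left: "trilinear a (p + p') q r = trilinear a p q r + trilinear a p' q r"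
  by (simp add: trilinear_def algebra_simps sum.distrib)

lemma trilinear_scale_left: "trilinear a (c *s p) q r = c * trilinear a p q r"
  by (simp add: trilinear_def sum_distrib_left mult_ac)

lemma trilinear_commute_left:
  assumes "\<And>i j k. a i j k = a j i k"
  shows "trilinear a p q r = trilinear a q p r"
  unfolding trilinear_def
  by (subst sum.swap, intro sum.cong refl, subst assms) (simp add: mult_ac)

lemma trilinear_commute_right:
  assumes "\<And>i j k. a i j k = a i k j"
  shows "trilinear a p q r = trilinear a p r q"
  unfolding trilinear_def
  by (rule sum.cong[OF refl], subst sum.swap, intro sum.cong refl, subst assms) (simp add: mult_ac)

text \<open>The rows of \<open>P\<close> are the new basis vectors and \<open>U\<close> the new coordinate functions, so
the new coefficients are the values of the trilinear form on basis vectors. In particular the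
coefficient of the cube of \<open>U i\<close> is the value of the cubic at the point \<open>P $ i\<close>.\<close>

lemma cubic_form_change_of_coordinates:
  fixes a :: "4 \<Rightarrow> 4 \<Rightarrow> 4 \<Rightarrow> complex" and P :: "complex^4^4"
  assumes "\<And>i. Var i = (\<Sum>j\<in>UNIV. Const (P $ j $ i) * U j)"
  shows "(\<Sum>i\<in>UNIV. \<Sum>j\<in>UNIV. \<Sum>k\<in>UNIV. Const (a i j k) * Var i * Var j * Var k) =
    (\<Sum>i\<in>UNIV. \<Sum>j\<in>UNIV. \<Sum>k\<in>UNIV. Const (trilinear a (P $ i) (P $ j) (P $ k)) * U i * U j * U k)"
proof -
  have "(\<Sum>i\<in>UNIV. \<Sum>j\<in>UNIV. \<Sum>k\<in>UNIV. Const (a i j k) * Var i * Var j * Var k) =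
    (\<Sum>(l, m, n)\<in>UNIV. \<Sum>(i, j, k)\<in>UNIV.
      Const (a l m n) * (Const (P $ i $ l) * U i) * (Const (P $ j $ m) * U j) * (Const (P $ k $ n) * U k))"
    unfolding assms by (simp only: product_of_three_sums) (rule sum_triples)
  also have "\<dots> = (\<Sum>(i, j, k)\<in>UNIV. \<Sum>(l, m, n)\<in>UNIV.
      Const (a l m n) * (Const (P $ i $ l) * U i) * (Const (P $ j $ m) * U j) * (Const (P $ k $ n) * U k))"
    by (simp only: split_def) (rule sum.swap)
  also have "\<dots> = (\<Sum>(i, j, k)\<in>UNIV. Const (trilinear a (P $ i) (P $ j) (P $ k)) * U i * U j * U k)"
    by (intro sum.cong refl)
       (auto simp: trilinear_def sum_triples Const_sum Const_simps sum_distrib_left sum_distrib_right split_def mult_ac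
             intro!: sum.cong)
  finally show ?thesis by (simp only: sum_triples)
qed

section \<open>Linear forms\<close>

definition linear_form :: "complex^4 \<Rightarrow> poly4" where
  "linear_form v = (\<Sum>k\<in>UNIV. Const (v $ k) * Var k)"

lemma linear_form_simps:
  "linear_form 0 = 0"
  "linear_form (v + w) = linear_form v + linear_form w"
  "linear_form (v - w) = linear_form v - linear_form w"
  "linear_form (c *s v) = Const c * linear_form v"
  by (simp_all add: linear_form_def Const_simps ring_distribs sum.distrib sum_subtractf sum_distrib_left mult.assoc)

lemma linear_form_sum: "linear_form (sum g S) = (\<Sum>s\<in>S. linear_form (g s))"
  by (induction S rule: infinite_finite_induct) (simp_all add: linear_form_simps)

lemma Var_eq_dual_coordinates:
  assumes "D ** P = mat 1"
  shows "Var i = (\<Sum>j\<in>UNIV. Const (P $ j $ i) * linear_form (column j D))"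
proof -
  have "(\<Sum>j\<in>UNIV. Const (P $ j $ i) * linear_form (column j D))
      = (\<Sum>k\<in>UNIV. Const ((D ** P) $ k $ i) * Var k)"
    unfolding linear_form_def sum_distrib_left matrix_matrix_mult_def
    by (subst sum.swap) (simp add: column_def Const_sum Const_simps sum_distrib_left sum_distrib_right mult_ac)
  also have "\<dots> = (\<Sum>k\<in>UNIV. if k = i then Var k else 0)"
    by (intro sum.cong) (auto simp: assms mat_def Const_simps)
  finally show ?thesis by simp
qed

section \<open>Bases adapted to the zero set\<close>

lemma scale_vector_matrix: "(c *s q) v* D = c *s (q v* D)"
  for D :: "'a::comm_semiring_1^'n^'m"
  by (simp add: vec_eq_iff vector_matrix_mult_def sum_distrib_left mult_ac)

text \<open>A maximal independent subset of \<open>Z\<close> is extended to a basis, the rows of \<open>P\<close>; the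
columns of \<open>D\<close> are the dual basis. A basis vector outside \<open>Z\<close> was added by the
extension, so its dual coordinate vanishes on the span of \<open>Z\<close>.\<close>

lemma basis_in_set_or_vanishing_coordinate:
  fixes Z :: "('a::field^'n) set"
  obtains P D :: "'a^'n^'n" where "P ** D = mat 1" "D ** P = mat 1"
    "(\<forall>i. P $ i \<in> Z) \<or> (\<exists>j. \<forall>p\<in>Z. (p v* D) $ j = 0)"
proof -
  obtain B where B: "B \<subseteq> Z" "vec.independent B" "Z \<subseteq> vec.span B"
    using vec.maximal_independent_subset by metis
  define E where "E = vec.extend_basis B"
  have E: "B \<subseteq> E" "vec.independent E" "vec.span E = UNIV"
    using vec.extend_basis_superset[OF B(2)] vec.independent_extend_basis[OF B(2)]
      vec.span_extend_basis[OF B(2)] by (simp_all add: E_def)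
  have "card E = vec.dim (UNIV :: ('a^'n) set)"
    using E by (intro vec.basis_card_eq_dim) auto
  then have "card (UNIV :: 'n set) = card E" by (simp add: vec_dim_card card_cart_basis)
  then obtain h :: "'n \<Rightarrow> 'a^'n" where h: "bij_betw h UNIV E"
    using finite_same_card_bij[of "UNIV :: 'n set" E] vec.finiteI_independent[OF E(2)] by auto
  define P where "P = (\<chi> i. h i)"
  have "rows P = E"
    using bij_betw_imp_surj_on[OF h] by (auto simp: rows_def P_def row_def)
  then obtain D where D: "D ** P = mat 1"
    using matrix_left_invertible_span_rows_gen[of P] E(3) by auto
  then have P: "P ** D = mat 1" by (simp add: matrix_left_right_inverse)
  show thesis
  proof (cases "E \<subseteq> Z")
    case True
    then have "\<forall>i. P $ i \<in> Z" using bij_betwE[OF h] by (auto simp: P_def)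
    with P D show thesis by (intro that[of P D]) auto
  next
    case False
    then obtain j where j: "h j \<notin> Z" using bij_betw_imp_surj_on[OF h] by auto
    have sub: "vec.subspace {p. (p v* D) $ j = 0}"
      by (simp add: vec.subspace_def vector_matrix_left_distrib scale_vector_matrix)
    have "B \<subseteq> {p. (p v* D) $ j = 0}"
    proof
      fix b assume b: "b \<in> B"
      then obtain i where i: "b = h i" using E(1) bij_betw_imp_surj_on[OF h] by auto
      then have "i \<noteq> j" using b B(1) j by auto
      have "(b v* D) $ j = (P ** D) $ i $ j"
        by (simp add: i P_def vector_matrix_mult_def matrix_matrix_mult_def mult.commute)
      then show "b \<in> {p. (p v* D) $ j = 0}" using P \<open>i \<noteq> j\<close> by (simp add: mat_def)
    qed
    then have "vec.span B \<subseteq> {p. (p v* D) $ j = 0}" using sub by (rule vec.span_minimal)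
    then have "\<forall>p\<in>Z. (p v* D) $ j = 0" using B(3) by auto
    with P D show thesis by (intro that[of P D]) auto
  qed
qed

section \<open>Cubics whose zeros lie in a plane\<close>

text \<open>On a line through a point \<open>e\<close> off the hyperplane and parallel to a vector \<open>q\<close> in
it, the cubic has no zero, so by the fundamental theorem of algebra it is constant there. Its
higher coefficients, which are values of the tensor on \<open>e\<close> and \<open>q\<close>, therefore vanish;
polarization extends this to different vectors of the hyperplane. What survives is a multiple of
the cube of the linear form that defines the hyperplane.\<close>

lemma tensor_concentrated_of_zeros_in_hyperplane:
  fixes a :: "'n::finite \<Rightarrow> 'n \<Rightarrow> 'n \<Rightarrow> complex" and P D :: "complex^'n^'n"
  assumes sym: "\<And>i j k. a i j k = a j i k" "\<And>i j k. a i j k = a i k j"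
    and dual: "P ** D = mat 1"
    and zeros: "\<And>p. trilinear a p p p = 0 \<Longrightarrow> (p v* D) $ m = 0"
    and ijk: "\<not> (i = m \<and> j = m \<and> k = m)"
  shows "trilinear a (P $ i) (P $ j) (P $ k) = 0"
proof -
  let ?T = "trilinear a"
  define e where "e = P $ m"
  define K where "K = {p. (p v* D) $ m = 0}"
  have coord: "(P $ i v* D) $ m = (if i = m then 1 else 0)" for i
  proof -
    have "(P $ i v* D) $ m = (P ** D) $ i $ m"
      by (simp add: vector_matrix_mult_def matrix_matrix_mult_def mult.commute)
    then show ?thesis by (simp add: dual mat_def)
  qed
  have K_add: "q + r \<in> K" if "q \<in> K" "r \<in> K" for q r
    using that by (simp add: K_def vector_matrix_left_distrib)
  have c1: "?T p q r = ?T q p r" for p q r by (rule trilinear_commute_left[OF sym(1)])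
  have c2: "?T p q r = ?T p r q" for p q r by (rule trilinear_commute_right[OF sym(2)])
  have add1: "?T (p + p') q r = ?T p q r + ?T p' q r" for p p' q r by (rule trilinear_add_left)
  have add2: "?T p (q + q') r = ?T p q r + ?T p q' r" for p q q' r by (metis c1 add1)
  have add3: "?T p q (r + r') = ?T p q r + ?T p q r'" for p q r r' by (metis c2 add2)
  have sc1: "?T (c *s p) q r = c * ?T p q r" for c p q r by (rule trilinear_scale_left)
  have sc2: "?T p (c *s q) r = c * ?T p q r" for c p q r by (metis c1 sc1)
  have sc3: "?T p q (c *s r) = c * ?T p q r" for c p q r by (metis c2 sc2)
  \<comment> \<open>The restriction of the cubic to the line through \<open>e\<close> in direction \<open>q\<close> is a constant.\<close>
  have line: "?T e e q = 0 \<and> ?T e q q = 0 \<and> ?T q q q = 0" if q: "q \<in> K" for q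
  proof -
    let ?p = "[:?T e e e, 3 * ?T e e q, 3 * ?T e q q, ?T q q q:]"
    have ev: "poly ?p s = ?T (e + s *s q) (e + s *s q) (e + s *s q)" for s
      using c1[of q e] c2[of q q e] c2[of e q e]
      by (simp add: add1 add2 add3 sc1 sc2 sc3 algebra_simps)
    have "((e + s *s q) v* D) $ m = 1" for s
      using q coord[of m] by (simp add: vector_matrix_left_distrib scale_vector_matrix K_def e_def)
    then have "poly ?p s \<noteq> 0" for s
      unfolding ev using zeros by (metis zero_neq_one)
    then have "degree ?p = 0"
      using fundamental_theorem_of_algebra constant_degree by blast
    then show ?thesis by (auto split: if_splits)
  qed
  \<comment> \<open>On the hyperplane the quadratic form \<open>?T e q q\<close> and the cubic form \<open>?T q q q\<close> vanish,
      hence so do their polarizations.\<close>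
  have eqr: "?T e q r = 0" if "q \<in> K" "r \<in> K" for q r
  proof -
    have "2 * ?T e q r = ?T e (q + r) (q + r) - ?T e q q - ?T e r r"
      using c2[of e r q] by (simp add: add2 add3)
    then show ?thesis using line that K_add by simp
  qed
  have qrs: "?T q r s = 0" if "q \<in> K" "r \<in> K" "s \<in> K" for q r s
  proof -
    have "6 * ?T q r s = ?T (q + r + s) (q + r + s) (q + r + s) - ?T (q + r) (q + r) (q + r)
       - ?T (q + s) (q + s) (q + s) - ?T (r + s) (r + s) (r + s) + ?T q q q + ?T r r r + ?T s s s"
      using c1 c2 by (simp add: add1 add2 add3)
    then show ?thesis using line that K_add by simp
  qed
  have PK: "P $ i \<in> K" if "i \<noteq> m" for i using coord[of i] that by (simp add: K_def)
  consider "i = m" "j = m" "k \<noteq> m" | "i = m" "j \<noteq> m" "k = m" | "i \<noteq> m" "j = m" "k = m"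
    | "i = m" "j \<noteq> m" "k \<noteq> m" | "i \<noteq> m" "j = m" "k \<noteq> m" | "i \<noteq> m" "j \<noteq> m" "k = m"
    | "i \<noteq> m" "j \<noteq> m" "k \<noteq> m" using ijk by blast
  then show ?thesis
    using line[OF PK] eqr[OF PK PK] qrs[OF PK PK PK] c1 c2 unfolding e_def
    by cases metis+
qed

section \<open>Cubics with four independent zeros\<close>

text \<open>If the first factors are transformed by \<open>N\<close>, the second ones have to be transformed by
the inverse transpose of \<open>N\<close>.\<close>

lemma rewrite_pairing_in_new_basis:
  fixes N :: "complex^'n::finite^'n" and x l' :: "'n::finite \<Rightarrow> complex^4"
  assumes "det N \<noteq> 0"
  obtains l where "(\<Sum>i\<in>UNIV. linear_form (x i) * linear_form (l' i)) =
    (\<Sum>j\<in>UNIV. linear_form (\<Sum>k\<in>UNIV. N $ j $ k *s x k) * linear_form (l j))"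
proof -
  obtain M where M: "M ** N = mat 1" using assms by (metis invertible_det_nz invertible_left_inverse)
  define l where "l j = (\<Sum>i\<in>UNIV. M $ i $ j *s l' i)" for j
  have "(\<Sum>j\<in>UNIV. linear_form (\<Sum>k\<in>UNIV. N $ j $ k *s x k) * linear_form (l j))
     = (\<Sum>j\<in>UNIV. \<Sum>i\<in>UNIV. \<Sum>k\<in>UNIV. Const (M $ i $ j * N $ j $ k) * linear_form (x k) * linear_form (l' i))"
    by (simp add: l_def linear_form_sum linear_form_simps Const_simps sum_product mult_ac)
  also have "\<dots> = (\<Sum>i\<in>UNIV. \<Sum>k\<in>UNIV. Const ((M ** N) $ i $ k) * linear_form (x k) * linear_form (l' i))"
    by (rule trans[OF sum.swap], rule sum.cong[OF refl], rule trans[OF sum.swap], rule sum.cong[OF refl])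
       (simp add: matrix_matrix_mult_def Const_sum sum_distrib_right)
  also have "\<dots> = (\<Sum>i\<in>UNIV. \<Sum>k\<in>UNIV. if k = i then linear_form (x k) * linear_form (l' i) else 0)"
    by (intro sum.cong refl) (auto simp: M mat_def Const_simps)
  finally show thesis by (intro that[of l]) simp
qed

text \<open>The diagonal entries have the prescribed sum \<open>s\<close>. As a function of \<open>k\<close> the determinant
is a polynomial with leading term \<open>- 2 k\<^sup>3\<close>, because the product of the diagonal entries
is the only term of degree three.\<close>

lemma exists_diagonal_with_nonzero_det:
  fixes s A B C D E F :: complex
  obtains k where "det (vector [vector [k, A, B], vector [C, k, D], vector [E, F, s - 2 * k]] :: complex^3^3) \<noteq> 0"
proof -
  let ?p = "[:A * D * E + B * C * F - s * A * C, 2 * A * C - D * F - B * E, s, - 2:]"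
  have "finite {k. poly ?p k = 0}" by (rule poly_roots_finite) simp
  then obtain k where k: "poly ?p k \<noteq> 0"
    using ex_new_if_finite[OF infinite_UNIV_char_0] by blast
  have "det (vector [vector [k, A, B], vector [C, k, D], vector [E, F, s - 2 * k]] :: complex^3^3) = poly ?p k"
    by (simp add: det_3 algebra_simps)
  with k show thesis by (intro that[of k]) simp
qed

text \<open>Write \<open>x, y, z, t\<close> for the coordinates. The part of the cubic that does not involve \<open>t\<close>
has no cubes, so it is \<open>b1 y z + b2 x z + b3 x y\<close> with linear forms \<open>b1, b2, b3\<close> in
\<open>x, y, z\<close>; the rest is \<open>t Q\<close>, where \<open>Q\<close> has no \<open>t\<^sup>2\<close> and so lies in
the ideal \<open>(x, y, z)\<close>. The coefficient of \<open>x y z\<close> can be distributed over the three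
\<open>b\<close>'s at will, and by the preceding lemma some distribution makes them linearly independent.
Then \<open>b1, b2, b3\<close> generate the same ideal, and \<open>Q = b1 l1 + b2 l2 + b3 l3\<close>.\<close>

lemma cubic_without_cubes_normal_form:
  fixes a :: "4 \<Rightarrow> 4 \<Rightarrow> 4 \<Rightarrow> complex" and u :: "4 \<Rightarrow> complex^4"
  assumes sym: "\<And>i j k. a i j k = a j i k" "\<And>i j k. a i j k = a i k j"
    and nocubes: "\<And>i. a i i i = 0"
    and f: "f = (\<Sum>i\<in>UNIV. \<Sum>j\<in>UNIV. \<Sum>k\<in>UNIV.
      Const (a i j k) * linear_form (u i) * linear_form (u j) * linear_form (u k))"
  obtains b1 b2 b3 l1 l2 l3 where
    "f = linear_form b1 * (linear_form l1 * linear_form (u 4) + linear_form (u 2) * linear_form (u 3))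
       + linear_form b2 * (linear_form l2 * linear_form (u 4) + linear_form (u 1) * linear_form (u 3))
       + linear_form b3 * (linear_form l3 * linear_form (u 4) + linear_form (u 1) * linear_form (u 2))"
proof -
  obtain k where k: "det (vector [vector [k, 3 * a 2 2 3, 3 * a 2 3 3],
     vector [3 * a 1 1 3, k, 3 * a 1 3 3],
     vector [3 * a 1 1 2, 3 * a 1 2 2, 6 * a 1 2 3 - 2 * k]] :: complex^3^3) \<noteq> 0"
    (is "det ?N \<noteq> 0") by (rule exists_diagonal_with_nonzero_det)
  \<comment> \<open>The pairing of \<open>x\<close> with \<open>l'\<close> is \<open>Q\<close>.\<close>
  define x :: "3 \<Rightarrow> complex^4" where "x i = (if i = 1 then u 1 else if i = 2 then u 2 else u 3)" for i
  define l' where "l' i = (if i = 1 then (3 * a 1 1 4) *s u 1 + (6 * a 1 2 4) *s u 2 + (6 * a 1 3 4) *s u 3 + (3 * a 1 4 4) *s u 4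
     else if i = 2 then (3 * a 2 2 4) *s u 2 + (6 * a 2 3 4) *s u 3 + (3 * a 2 4 4) *s u 4
     else (3 * a 3 3 4) *s u 3 + (3 * a 3 4 4) *s u 4)" for i :: 3
  define b where "b j = (\<Sum>k\<in>UNIV. ?N $ j $ k *s x k)" for j
  obtain l where l: "(\<Sum>i\<in>UNIV. linear_form (x i) * linear_form (l' i)) =
      (\<Sum>j\<in>UNIV. linear_form (b j) * linear_form (l j))"
    using rewrite_pairing_in_new_basis[OF k, of x l'] unfolding b_def by blast
  have syms: "a 2 1 k = a 1 2 k" "a 3 1 k = a 1 3 k" "a 4 1 k = a 1 4 k" "a 3 2 k = a 2 3 k"
    "a 4 2 k = a 2 4 k" "a 4 3 k = a 3 4 k"
    "a k 2 1 = a k 1 2" "a k 3 1 = a k 1 3" "a k 4 1 = a k 1 4" "a k 3 2 = a k 2 3"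
    "a k 4 2 = a k 2 4" "a k 4 3 = a k 3 4" for k
    using sym by blast+
  have "f = linear_form (u 4) * (\<Sum>i\<in>UNIV. linear_form (x i) * linear_form (l' i))
     + linear_form (b 1) * (linear_form (u 2) * linear_form (u 3))
     + linear_form (b 2) * (linear_form (u 1) * linear_form (u 3))
     + linear_form (b 3) * (linear_form (u 1) * linear_form (u 2))"
    unfolding f b_def
    by (simp add: sum_4 sum_3 x_def l'_def nocubes syms linear_form_simps Const_simps algebra_simps)
  then show thesis
    unfolding l sum_3
    by (intro that[of "b 1" "l 1" "b 2" "l 2" "b 3" "l 3"]) (simp add: algebra_simps)
qed

section \<open>Pfaffian cubics\<close>

text \<open>In the type \<open>4\<close> the numeral \<open>4\<close> denotes \<open>0\<close>, so the coordinate with index \<open>4\<close>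
above is the one with index \<open>0\<close>, with which the four variables begin.\<close>

lemma UNIV_4_from_0: "(UNIV :: 4 set) = {0, 1, 2, 3}"
proof (rule sym, rule card_seteq)
  show "card (UNIV :: 4 set) \<le> card {0, 1, 2, 3 :: 4}" by simp
qed auto

lemma linear_form_eq:
  "linear_form v = Var 0 * Const (v $ 0) + Var 1 * Const (v $ 1) + Var 2 * Const (v $ 2) + Var 3 * Const (v $ 3)"
  unfolding linear_form_def UNIV_4_from_0 by (simp add: ac_simps)

lemma Pfaffian_of_linear_forms:
  assumes "f = linear_form b1 * (linear_form l1 * linear_form t + linear_form y * linear_form z)
    + linear_form b2 * (linear_form l2 * linear_form t + linear_form x * linear_form z)
    + linear_form b3 * (linear_form l3 * linear_form t + linear_form x * linear_form y)"
  shows "Pfaffian f"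
proof -
  define w where "w i j = pfaffian_half x y z t b1 b2 b3 l1 l2 l3 i j - pfaffian_half x y z t b1 b2 b3 l1 l2 l3 j i" for i j
  define A :: "4 \<Rightarrow> complex^6^6" where "A k = (\<chi> i j. w i j $ k)" for k
  have skew: "skew_symmetric (A k)" for k
    by (simp add: skew_symmetric_def A_def w_def vec_eq_iff Finite_Cartesian_Product.transpose_def)
  have entries: "linear_form (pfaffian_half x y z t b1 b2 b3 l1 l2 l3 i j) =
      pfaffian_half (linear_form x) (linear_form y) (linear_form z) (linear_form t)
        (linear_form b1) (linear_form b2) (linear_form b3)
        (linear_form l1) (linear_form l2) (linear_form l3) i j" for i j
    by (simp add: pfaffian_half_def linear_form_simps)
  have "linear_matrix (A 0) (A 1) (A 2) (A 3) = (\<chi> i j. linear_form (w i j))"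
    by (simp add: linear_matrix_def A_def linear_form_eq)
  also have "\<dots> = (\<chi> i j. pfaffian_half (linear_form x) (linear_form y) (linear_form z) (linear_form t)
        (linear_form b1) (linear_form b2) (linear_form b3)
        (linear_form l1) (linear_form l2) (linear_form l3) i j
      - pfaffian_half (linear_form x) (linear_form y) (linear_form z) (linear_form t)
        (linear_form b1) (linear_form b2) (linear_form b3)
        (linear_form l1) (linear_form l2) (linear_form l3) j i)"
    by (simp only: w_def linear_form_simps entries)
  finally have "det (linear_matrix (A 0) (A 1) (A 2) (A 3)) = f\<^sup>2"
    by (simp only: det_skew_eq_square assms)
  with skew show ?thesis unfolding Pfaffian_def by blast
qed

theorem theorem1p1:
  fixes f :: poly4
  assumes "cubic_surface f"
  shows "Pfaffian f"
proof -
  obtain a where sym: "\<And>i j k. a i j k = a j i k" "\<And>i j k. a i j k = a i k j"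
    and f: "f = (\<Sum>i\<in>UNIV. \<Sum>j\<in>UNIV. \<Sum>k\<in>UNIV. Const (a i j k) * Var i * Var j * Var k)"
    using cubic_eq_symmetric_form[OF assms] by blast
  obtain P D :: "complex^4^4" where PD: "P ** D = mat 1" "D ** P = mat 1"
    and cases: "(\<forall>i. P $ i \<in> {p. trilinear a p p p = 0}) \<or>
      (\<exists>m. \<forall>p\<in>{p. trilinear a p p p = 0}. (p v* D) $ m = 0)"
    by (rule basis_in_set_or_vanishing_coordinate)
  define c where "c i j k = trilinear a (P $ i) (P $ j) (P $ k)" for i j k
  have f': "f = (\<Sum>i\<in>UNIV. \<Sum>j\<in>UNIV. \<Sum>k\<in>UNIV. Const (c i j k) *
      linear_form (column i D) * linear_form (column j D) * linear_form (column k D))"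
    unfolding f c_def by (rule cubic_form_change_of_coordinates) (rule Var_eq_dual_coordinates[OF PD(2)])
  from cases show ?thesis
  proof
    \<comment> \<open>The zeros span the space: no cubes of the new coordinates occur.\<close>
    assume zeros: "\<forall>i. P $ i \<in> {p. trilinear a p p p = 0}"
    have "c i j k = c j i k" "c i j k = c i k j" for i j k
      unfolding c_def by (rule trilinear_commute_left[OF sym(1)], rule trilinear_commute_right[OF sym(2)])
    moreover have "c i i i = 0" for i using zeros by (simp add: c_def)
    ultimately obtain b1 b2 b3 l1 l2 l3 where
      "f = linear_form b1 * (linear_form l1 * linear_form (column 4 D) + linear_form (column 2 D) * linear_form (column 3 D))
       + linear_form b2 * (linear_form l2 * linear_form (column 4 D) + linear_form (column 1 D) * linear_form (column 3 D))
       + linear_form b3 * (linear_form l3 * linear_form (column 4 D) + linear_form (column 1 D) * linear_form (column 2 D))"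
      using f' by (rule cubic_without_cubes_normal_form)
    then show ?thesis by (rule Pfaffian_of_linear_forms)
  next
    \<comment> \<open>The zeros lie in a plane: the cubic is \<open>d\<close> times the cube of a linear form,
      a product of three linear forms and hence the normal form with most entries zero.\<close>
    assume "\<exists>m. \<forall>p\<in>{p. trilinear a p p p = 0}. (p v* D) $ m = 0"
    then obtain m where m: "\<And>p. trilinear a p p p = 0 \<Longrightarrow> (p v* D) $ m = 0" by blast
    have "c i j k = 0" if "\<not> (i = m \<and> j = m \<and> k = m)" for i j k
      unfolding c_def by (rule tensor_concentrated_of_zeros_in_hyperplane[OF sym PD(1) m that])
    moreover define d where "d = c m m m"
    ultimately have "c i j k = (if k = m then if j = m then if i = m then d else 0 else 0 else 0)" for i j k
      by auto
    then have "f = (\<Sum>i\<in>UNIV. \<Sum>j\<in>UNIV. \<Sum>k\<in>UNIV. if k = m then if j = m then if i = m then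
       Const d * linear_form (column m D) * linear_form (column m D) * linear_form (column m D) else 0 else 0 else 0)"
      unfolding f' by (intro sum.cong refl) (simp add: Const_simps)
    then have "f = linear_form (d *s column m D) * (linear_form 0 * linear_form 0
          + linear_form (column m D) * linear_form (column m D))
       + linear_form 0 * (linear_form 0 * linear_form 0 + linear_form 0 * linear_form (column m D))
       + linear_form 0 * (linear_form 0 * linear_form 0 + linear_form 0 * linear_form (column m D))"
      by (simp add: linear_form_simps mult_ac)
    then show ?thesis by (rule Pfaffian_of_linear_forms)
  qed
qed

end
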